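(* Let $y:\mathbb{R}^N\to\mathbb{R}$ be a square-integrable function for a given probability measure $f_{\mathbf{X}}(\mathbf{x})\,d\mathbf{x}$ of $\mathbf{X}\in\mathbb{R}^N$. The generalized ADD component functions $y_{u,G}$, $u\subseteq\{1,\dots,N\}$, of $y$ satisfy $$y_{\emptyset,G}=\int_{\mathbb{R}^N}y(\mathbf{x})f_{\mathbf{X}}(\mathbf{x})\,d\mathbf{x},$$ and, for every $\emptyset\neq u\subseteq\{1,\dots,N\}$, $$y_{u,G}(\mathbf{X}_u)=\int_{\mathbb{R}^{N-|u|}}y(\mathbf{X}_u,\mathbf{x}_{-u})f_{-u}(\mathbf{x}_{-u})\,d\mathbf{x}_{-u}-\sum_{v\subset u}y_{v,G}(\mathbf{X}_v)-\sum_{\substack{\emptyset\neq v\subseteq\{1,\dots,N\}\\ v\cap u\neq\emptyset,\ v\nsubseteq u}}\int_{\mathbb{R}^{|v\cap -u|}}y_{v,G}(\mathbf{X}_{v\cap u},\mathbf{x}_{v\cap -u})f_{v\cap -u}(\mathbf{x}_{v\cap -u})\,d\mathbf{x}_{v\cap -u},$$ where $v\subset u$ denotes proper inclusion and the first sum includes $v=\emptyset$.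
   Context: Let $N\in\mathbb{N}$ and let $\mathbf{X}=(X_1,\dots,X_N)$ be an $\mathbb{R}^N$-valued random vector on a complete probability space, with joint probability density function $f_{\mathbf{X}}:\mathbb{R}^N\to[0,\infty)$, not necessarily of product type. For $u\subseteq\{1,\dots,N\}$, $|u|$ is its cardinality, $-u:=\{1,\dots,N\}\setminus u$, $v\cap -u:=v\cap(\{1,\dots,N\}\setminus u)$, $\mathbf{X}_u=(X_i)_{i\in u}$ and $\mathbf{x}_u=(x_i)_{i\in u}$. For $u\neq\emptyset$ the marginal density of $\mathbf{X}_u$ is $f_u(\mathbf{x}_u):=\int_{\mathbb{R}^{N-|u|}}f_{\mathbf{X}}(\mathbf{x})\,d\mathbf{x}_{-u}$. The notation $(\mathbf{X}_u,\mathbf{x}_{-u})$ means the $N$-dimensional vector whose $i$th component is $X_i$ if $i\in u$ and $x_i$ if $i\notin u$; similarly $(\mathbf{X}_{v\cap u},\mathbf{x}_{v\cap -u})$ is the $|v|$-dimensional vector with component $X_i$ for $i\in v\cap u$ and $x_i$ for $i\in v\setminus u$. If $u=\{1,\dots,N\}$, integration over $\mathbf{x}_{-u}$ is over the empty set of variables and is omitted. The support of $f_{\mathbf{X}}$ is assumed grid-closed: for any point $\mathbf{x}\in\mathrm{supp}(f_{\mathbf{X}})$ one can traverse in each coordinate direction and find another point $\mathbf{x}'\in\mathrm{supp}(f_{\mathbf{X}})$. All integrals written are understood to exist and be finite. Generalized ADD (ANOVA dimensional decomposition): the decomposition $y(\mathbf{X})=\sum_{u\subseteq\{1,\dots,N\}}y_{u,G}(\mathbf{X}_u)$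 of a square-integrable function $y$ (that is, $\mathbb{E}[y(\mathbf{X})^2]<\infty$), where $y_{\emptyset,G}$ is a constant, each $y_{u,G}$ with $u\ne\emptyset$ is a function of $\mathbf{x}_u$ with $\int_{\mathbb{R}^{|u|}}y_{u,G}^2(\mathbf{x}_u)f_u(\mathbf{x}_u)\,d\mathbf{x}_u<\infty$, and the weak annihilating conditions hold: $$\int_{\mathbb{R}}y_{u,G}(\mathbf{x}_u)f_u(\mathbf{x}_u)\,dx_i=0\quad\text{for every } i\in u\neq\emptyset$$ (for almost every value of the remaining variables $x_j$, $j\in u\setminus\{i\}$).
   Formalization: The decomposition of y is required almost everywhere for every product density f_u(x_u) f_{-u}(x_{-u}), not only almost surely in X; otherwise the formula, which evaluates y at (X_u, x_{-u}), can fail for dependent X, for instance with uniform density on an L-shaped set. *)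

theory Defs
  imports "HOL-Probability.Probability"
begin

text \<open>For a set \<open>u\<close> of coordinates, \<open>\<real>\<^sup>u\<close> is the space of extensional functions on \<open>u\<close>, with
  Lebesgue-Borel measure. \<open>merge u w (x, z)\<close> is the vector \<open>(x\<^sub>u, z\<^sub>w)\<close> on \<open>u \<union> w\<close>, for disjoint
  \<open>u\<close> and \<open>w\<close>. Lebesgue-Borel measure on \<open>\<real>\<^sup>u\<close> for empty \<open>u\<close> is the unit mass at the only point, so an
  integral over no variables is evaluation there.\<close>

abbreviation leb :: "nat set \<Rightarrow> (nat \<Rightarrow> real) measure" where
  "leb u \<equiv> PiM u (\<lambda>_. lborel)"

text \<open>If \<open>f\<close> is a probability density on \<open>\<real>\<^sup>N\<close>, then \<open>marginal N f {}\<close> is the constant 1.\<close>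

definition marginal ::
  "nat \<Rightarrow> ((nat \<Rightarrow> real) \<Rightarrow> real) \<Rightarrow> nat set \<Rightarrow> (nat \<Rightarrow> real) \<Rightarrow> real" where
  "marginal N f u x = (\<integral>z. f (merge u ({1..N} - u) (x, z)) \<partial>leb ({1..N} - u))"

definition density_support :: "nat \<Rightarrow> ((nat \<Rightarrow> real) \<Rightarrow> real) \<Rightarrow> (nat \<Rightarrow> real) set" where
  "density_support N f =
     product_topology (\<lambda>_. euclideanreal) {1..N} closure_of {x \<in> space (leb {1..N}). f x \<noteq> 0}"

definition grid_closed :: "nat \<Rightarrow> (nat \<Rightarrow> real) set \<Rightarrow> bool" where
  "grid_closed N S \<longleftrightarrow> (\<forall>x\<in>S. \<forall>i\<in>{1..N}. \<exists>t. t \<noteq> x i \<and> x(i := t) \<in> S)"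

text \<open>The family \<open>Y\<close> is a generalized ADD of \<open>y\<close> for the density \<open>f\<close>. The component \<open>Y {}\<close> is a
  function on the one-point space \<open>\<real>\<^sup>0\<close>, that is, a constant.

  Third clause: \<open>y(x) = (\<Sum>v. y\<^sub>v(x\<^sub>v))\<close> up to sets that are null for each of the laws with density
  \<open>f\<^sub>u(x\<^sub>u) f\<^sub>-\<^sub>u(x\<^sub>-\<^sub>u)\<close>. For \<open>u = {}\<close> this is the almost sure identity \<open>y(X) = (\<Sum>v. y\<^sub>v(X\<^sub>v))\<close>. The
  other \<open>u\<close> are needed because the component formulas evaluate \<open>y\<close> at points \<open>(X\<^sub>u, x\<^sub>-\<^sub>u)\<close>, which
  for dependent coordinates may lie outside the support of \<open>f\<close>, where the almost sure identity says
  nothing. This clause follows from the identity at all points of \<open>\<real>\<^sup>N\<close>, and also from the almost sure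
  identity when \<open>f\<close> vanishes only where all these product densities do (almost everywhere).

  Last clause: the weak annihilating conditions.\<close>

definition generalized_ADD ::
  "nat \<Rightarrow> ((nat \<Rightarrow> real) \<Rightarrow> real) \<Rightarrow> ((nat \<Rightarrow> real) \<Rightarrow> real) \<Rightarrow>
     (nat set \<Rightarrow> (nat \<Rightarrow> real) \<Rightarrow> real) \<Rightarrow> bool" where
  "generalized_ADD N f y Y \<longleftrightarrow>
     (\<forall>u. u \<subseteq> {1..N} \<longrightarrow> Y u \<in> borel_measurable (leb u)) \<and>
     (\<forall>u. u \<subseteq> {1..N} \<and> u \<noteq> {} \<longrightarrow> integrable (leb u) (\<lambda>x. (Y u x)\<^sup>2 * marginal N f u x)) \<and>
     (\<forall>u. u \<subseteq> {1..N} \<longrightarrow>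
        (AE x in leb {1..N}.
           marginal N f u (restrict x u) * marginal N f ({1..N} - u) (restrict x ({1..N} - u)) \<noteq> 0
           \<longrightarrow> y x = (\<Sum>v\<in>Pow {1..N}. Y v (restrict x v)))) \<and>
     (\<forall>u i. u \<subseteq> {1..N} \<and> i \<in> u \<longrightarrow>
        (AE x in leb (u - {i}). (\<integral>t. Y u (x(i := t)) * marginal N f u (x(i := t)) \<partial>lborel) = 0))"

end

theory Submission
  imports Defs
begin

text \<open>Integrate the identity \<open>y = (\<Sum>v. Y v)\<close> over \<open>x\<^sub>-\<^sub>u\<close> against \<open>f\<^sub>-\<^sub>u\<close>, with \<open>x\<^sub>u = X\<^sub>u\<close>. Because
  marginals of marginals are marginals, the density \<open>f\<^sub>-\<^sub>u\<close> may be replaced by \<open>f\<^bsub>v - u\<^esub>\<close> in the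
  term of \<open>v\<close>. The terms with \<open>v \<subseteq> u\<close> are then constants, and those with \<open>v \<noteq> {}\<close> disjoint from \<open>u\<close>
  vanish by the weak annihilating conditions.\<close>

text \<open>Keeps \<open>{1..N}\<close> from being rewritten to \<open>{Suc 0..N}\<close>.\<close>

declare One_nat_def [simp del]

section \<open>Lebesgue measure on coordinate spaces\<close>

interpretation lborel_product: product_sigma_finite "\<lambda>_::nat. lborel :: real measure"
  by standard

text \<open>Here \<open>x\<close> may be any function: \<open>merge\<close> reads it only on
  \<open>J\<close> and makes the result extensional. So \<open>X \<omega>\<close> can later be
  inserted without being restricted first.\<close>

lemma measurable_merge_snd:
  "(\<lambda>z. merge J K (x, z)) \<in> leb K \<rightarrow>\<^sub>M leb (J \<union> K)"
  by (rule measurable_PiM_single') (auto simp: merge_def extensional_def PiE_def)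

text \<open>Fubini for null sets: \<open>leb (J \<union> K)\<close> is the image of the product
  measure under \<open>merge\<close>.\<close>

lemma AE_leb_merge:
  assumes "finite J" "finite K" "J \<inter> K = {}" "AE x in leb (J \<union> K). P x"
  shows "AE x in leb J. AE z in leb K. P (merge J K (x, z))"
proof -
  interpret K: sigma_finite_measure "leb K"
    using assms by (intro lborel_product.sigma_finite)
  interpret J: sigma_finite_measure "leb J"
    using assms by (intro lborel_product.sigma_finite)
  interpret P: pair_sigma_finite "leb J" "leb K" ..
  have "AE p in leb J \<Otimes>\<^sub>M leb K. P (merge J K p)"
    using assms(4) by (intro AE_distrD[OF measurable_merge])
      (subst lborel_product.distr_merge[OF assms(3,1,2)])
  then show ?thesis
    by (rule P.AE_pair)
qed

section \<open>Marginal densities and the laws they define\<close>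

locale joint_density =
  fixes N :: nat and f :: "(nat \<Rightarrow> real) \<Rightarrow> real"
  assumes f_measurable [measurable]: "f \<in> borel_measurable (leb {1..N})"
    and f_nonneg: "\<And>x. x \<in> space (leb {1..N}) \<Longrightarrow> 0 \<le> f x"
    and prob_f: "prob_space (density (leb {1..N}) (\<lambda>x. ennreal (f x)))"
begin

text \<open>The distribution of the subvector X_u. Integrals weighted by a marginal density become
  expectations, open to pushforward arguments.\<close>

abbreviation law :: "nat set \<Rightarrow> (nat \<Rightarrow> real) measure" where
  "law u \<equiv> density (leb u) (\<lambda>x. ennreal (marginal N f u x))"

lemma measurable_f_merge:
  assumes "u \<subseteq> {1..N}"
  shows "(\<lambda>p. f (merge u ({1..N} - u) p)) \<in> borel_measurable (leb u \<Otimes>\<^sub>M leb ({1..N} - u))"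
proof -
  have "u \<union> ({1..N} - u) = {1..N}" using assms by auto
  then have "merge u ({1..N} - u) \<in> leb u \<Otimes>\<^sub>M leb ({1..N} - u) \<rightarrow>\<^sub>M leb {1..N}"
    using measurable_merge[of u "{1..N} - u" "\<lambda>_::nat. lborel :: real measure"] by simp
  then show ?thesis by (rule measurable_compose[OF _ f_measurable])
qed

lemma marginal_measurable:
  assumes "u \<subseteq> {1..N}"
  shows "marginal N f u \<in> borel_measurable (leb u)"
proof -
  interpret sigma_finite_measure "leb ({1..N} - u)"
    by (intro lborel_product.sigma_finite) auto
  show ?thesis
    using measurable_f_merge[OF assms] unfolding marginal_def
    by (intro borel_measurable_lebesgue_integral) (auto simp: split_def)
qed

lemma merge_space:
  assumes "u \<subseteq> {1..N}"
  shows "merge u ({1..N} - u) (x, z) \<in> space (leb {1..N})"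
  using assms by (auto simp: space_PiM PiE_def extensional_def merge_def)

lemma marginal_nonneg:
  assumes "u \<subseteq> {1..N}"
  shows "0 \<le> marginal N f u x"
  unfolding marginal_def using merge_space[OF assms] f_nonneg by (intro integral_nonneg_AE) auto

lemma marginal_UNIV:
  assumes "x \<in> space (leb {1..N})"
  shows "marginal N f {1..N} x = f x"
proof -
  have "merge {1..N} {} (x, z) = x" for z
    using assms by (auto simp: space_PiM PiE_def extensional_def merge_def)
  then show ?thesis
    by (simp add: marginal_def PiM_empty lebesgue_integral_count_space_finite)
qed

lemma nn_integral_f: "(\<integral>\<^sup>+x. ennreal (f x) \<partial>leb {1..N}) = 1"
proof -
  interpret prob_space "density (leb {1..N}) (\<lambda>x. ennreal (f x))" by (rule prob_f)
  show ?thesis using emeasure_space_1 by (simp add: emeasure_density cong: nn_integral_cong_simp)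
qed

text \<open>The Bochner integral in \<open>marginal\<close> defaults to 0 on fibres where
  \<open>f\<close> has infinite integral. By Tonelli the fibre integrals have total integral 1, so
  such fibres are negligible.\<close>

lemma AE_marginal_eq_nn_integral:
  assumes u: "u \<subseteq> {1..N}"
  shows "AE x in leb u. ennreal (marginal N f u x) =
    (\<integral>\<^sup>+z. ennreal (f (merge u ({1..N} - u) (x, z))) \<partial>leb ({1..N} - u))"
proof -
  let ?w = "{1..N} - u"
  let ?g = "\<lambda>x. \<integral>\<^sup>+z. ennreal (f (merge u ?w (x, z))) \<partial>leb ?w"
  interpret w: sigma_finite_measure "leb ?w"
    by (intro lborel_product.sigma_finite) auto
  have un: "u \<union> ?w = {1..N}" and fin: "finite u" using u finite_subset by auto
  note [measurable] = measurable_f_merge[OF u]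
  have "(\<integral>\<^sup>+x. ?g x \<partial>leb u) = (\<integral>\<^sup>+x. ennreal (f x) \<partial>leb {1..N})"
    using lborel_product.product_nn_integral_fold[of u ?w "\<lambda>x. ennreal (f x)"] fin un by simp
  moreover have "?g \<in> borel_measurable (leb u)"
    by (intro w.borel_measurable_nn_integral) (auto simp: split_def)
  ultimately have "AE x in leb u. ?g x \<noteq> \<infinity>"
    using nn_integral_f by (intro nn_integral_PInf_AE) auto
  then show ?thesis
  proof eventually_elim
    case (elim x)
    have m: "(\<lambda>z. f (merge u ?w (x, z))) \<in> borel_measurable (leb ?w)"
      using measurable_merge_snd[of u ?w x] un by (intro measurable_compose[OF _ f_measurable]) auto
    have nn: "0 \<le> f (merge u ?w (x, z))" for z
      using merge_space[OF u] f_nonneg by auto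
    have "integrable (leb ?w) (\<lambda>z. f (merge u ?w (x, z)))"
      using m elim nn by (intro integrableI_nonneg) (auto simp: less_top)
    then show ?case
      unfolding marginal_def using nn by (simp add: nn_integral_eq_integral)
  qed
qed

text \<open>Tonelli along the splitting of the coordinates into \<open>u\<close> and its complement.
  Seen as the image of the joint law under restriction, a marginal law is a probability measure and
  restricts consistently.\<close>

lemma law_eq_distr:
  assumes u: "u \<subseteq> {1..N}"
  shows "law u = distr (density (leb {1..N}) (\<lambda>x. ennreal (f x))) (leb u) (\<lambda>x. restrict x u)"
    (is "_ = ?D")
proof (rule measure_eqI)
  fix A assume "A \<in> sets (law u)"
  then have A [measurable]: "A \<in> sets (leb u)" by simp
  let ?w = "{1..N} - u"
  have un: "u \<union> ?w = {1..N}" and fin: "finite u" using u finite_subset by auto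
  note [measurable] = measurable_f_merge[OF u] marginal_measurable[OF u] measurable_restrict_subset[OF u]
  have "emeasure (law u) A = (\<integral>\<^sup>+x. ennreal (marginal N f u x) * indicator A x \<partial>leb u)"
    by (simp add: emeasure_density)
  also have "\<dots> = (\<integral>\<^sup>+x. (\<integral>\<^sup>+z. ennreal (f (merge u ?w (x, z))) \<partial>leb ?w) * indicator A x \<partial>leb u)"
    using AE_marginal_eq_nn_integral[OF u] by (intro nn_integral_cong_AE) auto
  \<comment> \<open>Restricting to \<open>u\<close> undoes the merge, so the indicator can go into
    the inner integral; the double integral is then one over all coordinates.\<close>
  also have "\<dots> = (\<integral>\<^sup>+x. (\<integral>\<^sup>+z. ennreal (f (merge u ?w (x, z))) *
      indicator A (restrict (merge u ?w (x, z)) u) \<partial>leb ?w) \<partial>leb u)"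
  proof (rule nn_integral_cong)
    fix x assume "x \<in> space (leb u)"
    then have "restrict (merge u ?w (x, z)) u = x" for z
      by (auto simp: space_PiM PiE_def extensional_def merge_def)
    moreover have "(\<lambda>z. f (merge u ?w (x, z))) \<in> borel_measurable (leb ?w)"
      using measurable_merge_snd[of u ?w x] un by (intro measurable_compose[OF _ f_measurable]) auto
    ultimately show "(\<integral>\<^sup>+z. ennreal (f (merge u ?w (x, z))) \<partial>leb ?w) * indicator A x =
      (\<integral>\<^sup>+z. ennreal (f (merge u ?w (x, z))) * indicator A (restrict (merge u ?w (x, z)) u) \<partial>leb ?w)"
      by (simp add: nn_integral_multc)
  qed
  also have "\<dots> = (\<integral>\<^sup>+x. ennreal (f x) * indicator A (restrict x u) \<partial>leb {1..N})"
    using lborel_product.product_nn_integral_fold[of u ?w "\<lambda>x. ennreal (f x) * indicator A (restrict x u)"]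
      fin un by simp
  also have "\<dots> = emeasure ?D A"
    by (subst emeasure_distr, simp, simp, subst emeasure_density)
      (auto intro!: nn_integral_cong simp: indicator_def)
  finally show "emeasure (law u) A = emeasure ?D A" .
qed simp

lemma prob_space_law:
  assumes "u \<subseteq> {1..N}"
  shows "prob_space (law u)"
  unfolding law_eq_distr[OF assms]
  by (intro prob_space.prob_space_distr prob_f) (use measurable_restrict_subset[OF assms] in simp)

text \<open>Restricting to \<open>s\<close> and then to \<open>w\<close> is restricting to
  \<open>w\<close>. With \<open>s = {1..N} - u\<close> and \<open>w = v - u\<close>, this
  consistency is what replaces f_{-u} by the marginal density of the coordinates in
  \<open>v - u\<close>.\<close>

lemma law_restrict:
  assumes "w \<subseteq> s" "s \<subseteq> {1..N}"
  shows "law w = distr (law s) (leb w) (\<lambda>x. restrict x w)"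
proof -
  have w: "w \<subseteq> {1..N}" using assms by auto
  have "s \<inter> w = w" using assms by auto
  then show ?thesis
    unfolding law_eq_distr[OF w] law_eq_distr[OF assms(2)]
    using measurable_restrict_subset[OF assms(1)] measurable_restrict_subset[OF assms(2)]
    by (subst distr_distr) (auto simp: comp_def)
qed

section \<open>Integrals against marginal laws\<close>

lemma integrable_law:
  assumes "u \<subseteq> {1..N}" "g \<in> borel_measurable (leb u)"
  shows "integrable (law u) g \<longleftrightarrow> integrable (leb u) (\<lambda>x. g x * marginal N f u x)"
  using assms marginal_measurable marginal_nonneg
  by (subst integrable_density) (auto simp: mult.commute)

lemma integral_law:
  fixes g :: "(nat \<Rightarrow> real) \<Rightarrow> real"
  assumes "u \<subseteq> {1..N}" "g \<in> borel_measurable (leb u)"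
  shows "integral\<^sup>L (law u) g = (\<integral>x. g x * marginal N f u x \<partial>leb u)"
  using assms marginal_measurable marginal_nonneg
  by (subst integral_density) (auto simp: mult.commute)

text \<open>On a probability space L^2 lies in L^1. The decomposition bounds second moments, whereas
  Fubini and linearity call for first moments.\<close>

lemma integrable_law_of_square:
  fixes g :: "(nat \<Rightarrow> real) \<Rightarrow> real"
  assumes u: "u \<subseteq> {1..N}" and g [measurable]: "g \<in> borel_measurable (leb u)"
    and sq: "integrable (leb u) (\<lambda>x. (g x)\<^sup>2 * marginal N f u x)"
  shows "integrable (law u) g"
proof -
  interpret prob_space "law u" by (rule prob_space_law[OF u])
  have "integrable (law u) (\<lambda>x. (g x)\<^sup>2)"
    using integrable_law[OF u, of "\<lambda>x. (g x)\<^sup>2"] sq by simp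
  then show ?thesis
    by (rule square_integrable_imp_integrable[rotated]) simp
qed

text \<open>Fubini with coordinate \<open>i\<close> innermost: the annihilating condition makes the
  inner integral vanish for almost all values of the other coordinates.\<close>

lemma integral_law_annihilated:
  fixes g :: "(nat \<Rightarrow> real) \<Rightarrow> real"
  assumes u: "u \<subseteq> {1..N}" and i: "i \<in> u" and g: "g \<in> borel_measurable (leb u)"
    and int: "integrable (law u) g"
    and ann: "AE x in leb (u - {i}). (\<integral>t. g (x(i := t)) * marginal N f u (x(i := t)) \<partial>lborel) = 0"
  shows "integral\<^sup>L (law u) g = 0"
proof -
  have fin: "finite u" using i u finite_subset by auto
  have "integral\<^sup>L (law u) g =
      (\<integral>x. (\<integral>t. g (x(i := t)) * marginal N f u (x(i := t)) \<partial>lborel) \<partial>leb (u - {i}))"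
    using lborel_product.product_integral_insert[of "u - {i}" i "\<lambda>x. g x * marginal N f u x"]
      int g u fin by (simp add: insert_absorb[OF i] integrable_law integral_law)
  also have "\<dots> = 0"
    by (rule integral_eq_zero_AE[OF ann])
  finally show ?thesis .
qed

section \<open>Integrating the decomposition over the coordinates outside \<open>u\<close>\<close>

lemma integral_y_law:
  assumes u: "u \<subseteq> {1..N}" and ADD: "generalized_ADD N f y Y"
    and y [measurable]: "y \<in> borel_measurable (leb {1..N})"
    and eq: "AE z in leb ({1..N} - u). marginal N f ({1..N} - u) z \<noteq> 0 \<longrightarrow>
      y (merge u ({1..N} - u) (x, z)) = (\<Sum>v\<in>Pow {1..N}. Y v (restrict (merge u ({1..N} - u) (x, z)) v))"
    and int: "\<And>v. v \<subseteq> {1..N} \<Longrightarrow> v \<inter> u \<noteq> {} \<Longrightarrow> \<not> v \<subseteq> u \<Longrightarrow>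
      integrable (leb (v - u)) (\<lambda>z. Y v (merge (v \<inter> u) (v - u) (x, z)) * marginal N f (v - u) z)"
  shows "(\<integral>z. y (merge u ({1..N} - u) (x, z)) * marginal N f ({1..N} - u) z \<partial>leb ({1..N} - u)) =
      (\<Sum>v\<in>Pow u. Y v (restrict x v)) +
      (\<Sum>v | v \<noteq> {} \<and> v \<subseteq> {1..N} \<and> v \<inter> u \<noteq> {} \<and> \<not> v \<subseteq> u.
        \<integral>z. Y v (merge (v \<inter> u) (v - u) (x, z)) * marginal N f (v - u) z \<partial>leb (v - u))"
proof -
  let ?w = "{1..N} - u"
  let ?y = "\<lambda>z. y (merge u ?w (x, z))"
  \<comment> \<open>Component \<open>v\<close> at a fixed outcome \<open>x\<close>: the coordinates
    in \<open>v \<inter> u\<close> are frozen and those in \<open>v - u\<close> are free.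
    \<open>?T v\<close> is its mean over the free ones. One expression thus covers all
    \<open>v\<close>, also those inside \<open>u\<close> or disjoint from it.\<close>
  let ?h = "\<lambda>v z. Y v (merge (v \<inter> u) (v - u) (x, z))"
  let ?T = "\<lambda>v. integral\<^sup>L (law (v - u)) (?h v)"
  let ?A = "{v. v \<noteq> {} \<and> v \<subseteq> {1..N} \<and> v \<inter> u \<noteq> {} \<and> \<not> v \<subseteq> u}"
  have un: "u \<union> ?w = {1..N}" using u by auto
  have w: "?w \<subseteq> {1..N}" by auto
  have Ym: "Y v \<in> borel_measurable (leb v)" if "v \<subseteq> {1..N}" for v
    using ADD that by (simp add: generalized_ADD_def)
  have hm: "?h v \<in> borel_measurable (leb (v - u))" if "v \<subseteq> {1..N}" for v
    using measurable_merge_snd[of "v \<inter> u" "v - u" x]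
    by (intro measurable_compose[OF _ Ym[OF that]]) (simp add: Int_Diff_Un)
  have ym: "?y \<in> borel_measurable (leb ?w)"
    using measurable_merge_snd[of u ?w x] un by (intro measurable_compose[OF _ y]) auto
  have Y_law: "integrable (law v) (Y v) \<and> integral\<^sup>L (law v) (Y v) = 0"
    if v: "v \<subseteq> {1..N}" "v \<noteq> {}" for v
  proof -
    have i: "integrable (law v) (Y v)"
      using ADD v by (intro integrable_law_of_square Ym) (auto simp: generalized_ADD_def)
    obtain i where "i \<in> v" using v by auto
    then have "integral\<^sup>L (law v) (Y v) = 0"
      using ADD v i by (intro integral_law_annihilated Ym) (auto simp: generalized_ADD_def)
    with i show ?thesis by simp
  qed
  have h_disjoint: "Y v (merge {} v (x, z)) = Y v z" if "z \<in> space (leb v)" for v z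
  proof -
    have "merge {} v (x, z) = z"
      using that by (auto simp: merge_def space_PiM PiE_def extensional_def fun_eq_iff)
    then show ?thesis by simp
  qed
  have h_subset: "?h v z = Y v (restrict x v)" if "v \<subseteq> u" for v z
  proof -
    have "merge (v \<inter> u) (v - u) (x, z) = restrict x v"
      using that by (auto simp: merge_def fun_eq_iff)
    then show ?thesis by simp
  qed
  have hi: "integrable (law (v - u)) (?h v)" if v: "v \<subseteq> {1..N}" for v
  proof -
    \<comment> \<open>Respectively a constant, a full component that is integrable because its
      square is, and a mixed term covered by \<open>int\<close>. The empty \<open>v\<close> belongs
      to the first case.\<close>
    consider "v \<subseteq> u" | "v \<noteq> {}" "v \<inter> u = {}" | "v \<inter> u \<noteq> {}" "\<not> v \<subseteq> u" by auto
    then show ?thesis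
    proof cases
      case 1
      interpret prob_space "law (v - u)" using v by (intro prob_space_law) auto
      show ?thesis using h_subset[OF 1] by simp
    next
      case 2
      then have "v - u = v" by auto
      moreover have "integrable (law v) (\<lambda>z. Y v (merge {} v (x, z)))"
        using Y_law[OF v 2(1)] h_disjoint
        by (subst Bochner_Integration.integrable_cong[OF refl, of _ _ "Y v"]) auto
      ultimately show ?thesis using 2 by simp
    next
      case 3
      then show ?thesis using int[OF v 3] hm[OF v] v by (subst integrable_law) auto
    qed
  qed
  have hT0: "?T v = 0" if "v \<subseteq> {1..N}" "v \<noteq> {}" "v \<inter> u = {}" for v
  proof -
    have "v - u = v" using that by auto
    moreover have "(\<integral>z. Y v (merge {} v (x, z)) \<partial>law v) = 0"
      using Y_law[OF that(1,2)] h_disjoint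
      by (subst Bochner_Integration.integral_cong[OF refl, of _ _ "Y v"]) auto
    ultimately show ?thesis using that by simp
  qed
  \<comment> \<open>No free coordinate remains, and a constant is its own mean under a probability
    law.\<close>
  have hTc: "?T v = Y v (restrict x v)" if "v \<subseteq> u" for v
  proof -
    interpret prob_space "law (v - u)" using that u by (intro prob_space_law) auto
    show ?thesis using h_subset[OF that] prob_space by simp
  qed
  \<comment> \<open>By \<open>law_restrict\<close>, a function of the coordinates in
    \<open>v - u\<close> has the same mean under \<open>law ?w\<close> as under
    \<open>law (v - u)\<close>. This brings all terms under one law.\<close>
  have pull: "integrable (law ?w) (\<lambda>z. ?h v (restrict z (v - u)))"
      "(\<integral>z. ?h v (restrict z (v - u)) \<partial>law ?w) = ?T v" if v: "v \<subseteq> {1..N}" for v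
  proof -
    have sub: "v - u \<subseteq> ?w" using v by auto
    have m: "(\<lambda>z. restrict z (v - u)) \<in> law ?w \<rightarrow>\<^sub>M leb (v - u)"
      using measurable_restrict_subset[OF sub] by simp
    show "integrable (law ?w) (\<lambda>z. ?h v (restrict z (v - u)))"
      using hi[OF v] integrable_distr_eq[OF m hm[OF v]] law_restrict[OF sub w] by simp
    show "(\<integral>z. ?h v (restrict z (v - u)) \<partial>law ?w) = ?T v"
      using integral_distr[OF m hm[OF v]] law_restrict[OF sub w] by simp
  qed
  have h_restrict: "Y v (restrict (merge u ?w (x, z)) v) = ?h v (restrict z (v - u))"
    if "v \<subseteq> {1..N}" for v z
  proof -
    have "restrict (merge u ?w (x, z)) v = merge (v \<inter> u) (v - u) (x, restrict z (v - u))"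
      using that by (auto simp: merge_def fun_eq_iff)
    then show ?thesis by simp
  qed
  have "(\<Sum>v\<in>Pow {1..N}. Y v (restrict (merge u ?w (x, z)) v)) =
      (\<Sum>v\<in>Pow {1..N}. ?h v (restrict z (v - u)))" for z
    by (intro sum.cong refl h_restrict) simp
  then have "AE z in leb ?w. marginal N f ?w z \<noteq> 0 \<longrightarrow>
      ?y z = (\<Sum>v\<in>Pow {1..N}. ?h v (restrict z (v - u)))"
    using eq by (simp only:)
  \<comment> \<open>\<open>AE_density\<close> asks for positivity in \<open>ennreal\<close>, which
    implies that the real density is nonzero.\<close>
  then have "AE z in leb ?w. 0 < ennreal (marginal N f ?w z) \<longrightarrow>
      ?y z = (\<Sum>v\<in>Pow {1..N}. ?h v (restrict z (v - u)))"
    by (rule eventually_mono) (metis ennreal_0 less_irrefl)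
  then have "AE z in law ?w. ?y z = (\<Sum>v\<in>Pow {1..N}. ?h v (restrict z (v - u)))"
    using marginal_measurable[OF w] by (subst AE_density) (auto simp del: restrict_apply)
  then have "integral\<^sup>L (law ?w) ?y = (\<integral>z. (\<Sum>v\<in>Pow {1..N}. ?h v (restrict z (v - u))) \<partial>law ?w)"
    using ym pull(1) by (intro integral_cong_AE) (auto intro!: borel_measurable_sum)
  also have "\<dots> = (\<Sum>v\<in>Pow {1..N}. ?T v)"
    using pull by (subst Bochner_Integration.integral_sum) auto
  \<comment> \<open>The subsets left out are nonempty and disjoint from \<open>u\<close>;
    \<open>hT0\<close> removes them.\<close>
  also have "\<dots> = (\<Sum>v\<in>Pow u \<union> ?A. ?T v)"
    by (intro sum.mono_neutral_right ballI hT0) (use u in auto)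
  also have "\<dots> = (\<Sum>v\<in>Pow u. ?T v) + (\<Sum>v\<in>?A. ?T v)"
    using u by (intro sum.union_disjoint) (auto intro: finite_subset)
  also have "(\<Sum>v\<in>Pow u. ?T v) = (\<Sum>v\<in>Pow u. Y v (restrict x v))"
    using hTc by (intro sum.cong) auto
  also have "(\<Sum>v\<in>?A. ?T v) = (\<Sum>v\<in>?A. \<integral>z. ?h v z * marginal N f (v - u) z \<partial>leb (v - u))"
    using hm by (intro sum.cong integral_law) auto
  finally show ?thesis
    by (simp only: integral_law[OF w ym])
qed

text \<open>Points \<open>x\<close> with f_u(x) = 0 are null for \<open>law u\<close>. At almost all
  others f_u(x) is a nonzero factor, so on the fibre over \<open>x\<close> the condition on the
  product of densities reduces to one on f_{-u}.\<close>

lemma AE_product_law: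
  assumes u: "u \<subseteq> {1..N}"
    and AE: "AE x in leb {1..N}. marginal N f u (restrict x u) *
      marginal N f ({1..N} - u) (restrict x ({1..N} - u)) \<noteq> 0 \<longrightarrow> P x"
  shows "AE x in law u. AE z in leb ({1..N} - u).
    marginal N f ({1..N} - u) z \<noteq> 0 \<longrightarrow> P (merge u ({1..N} - u) (x, z))"
proof -
  let ?w = "{1..N} - u"
  have un: "u \<union> ?w = {1..N}" and fin: "finite u" using u finite_subset by auto
  have "AE x in leb u. AE z in leb ?w.
      marginal N f u (restrict (merge u ?w (x, z)) u) *
      marginal N f ?w (restrict (merge u ?w (x, z)) ?w) \<noteq> 0 \<longrightarrow> P (merge u ?w (x, z))"
    using AE fin by (intro AE_leb_merge) (simp_all only: un finite_atLeastAtMost finite_Diff Diff_disjoint)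
  then have "AE x in leb u. 0 < marginal N f u x \<longrightarrow>
    (AE z in leb ?w. marginal N f ?w z \<noteq> 0 \<longrightarrow> P (merge u ?w (x, z)))"
    using AE_space
  proof eventually_elim
    case x: (elim x)
    show ?case
    proof
      assume pos: "0 < marginal N f u x"
      from x(1) AE_space show "AE z in leb ?w. marginal N f ?w z \<noteq> 0 \<longrightarrow> P (merge u ?w (x, z))"
      proof eventually_elim
        case (elim z)
        have "restrict (merge u ?w (x, z)) u = x" "restrict (merge u ?w (x, z)) ?w = z"
          using x(2) elim(2) by (auto simp: merge_def space_PiM PiE_def extensional_def)
        then show ?case
          using elim(1) pos by simp
      qed
    qed
  qed
  then show ?thesis
    using marginal_measurable[OF u] by (subst AE_density) auto
qed

end

section \<open>Passage from laws to the random vector\<close>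

theorem theorem4p4:
  fixes N :: nat
    and M :: "'a measure"
    and X :: "'a \<Rightarrow> nat \<Rightarrow> real"
    and f y :: "(nat \<Rightarrow> real) \<Rightarrow> real"
    and Y :: "nat set \<Rightarrow> (nat \<Rightarrow> real) \<Rightarrow> real"
  assumes "prob_space M" and "complete_measure M"
    and "\<And>x. x \<in> space (leb {1..N}) \<Longrightarrow> 0 \<le> f x"
    and "distributed M (leb {1..N}) X (\<lambda>x. ennreal (f x))"
    and "grid_closed N (density_support N f)"
    and "y \<in> borel_measurable (leb {1..N})"
    and "integrable M (\<lambda>\<omega>. (y (X \<omega>))\<^sup>2)"
    and "generalized_ADD N f y Y"
    and y_integrals_exist: "\<And>u. u \<subseteq> {1..N} \<Longrightarrow> u \<noteq> {} \<Longrightarrow>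
      AE \<omega> in M. integrable (leb ({1..N} - u))
        (\<lambda>z. y (merge u ({1..N} - u) (X \<omega>, z)) * marginal N f ({1..N} - u) z)"
    and Y_integrals_exist: "\<And>u v. u \<subseteq> {1..N} \<Longrightarrow> v \<subseteq> {1..N} \<Longrightarrow> v \<inter> u \<noteq> {} \<Longrightarrow> \<not> v \<subseteq> u \<Longrightarrow>
      AE \<omega> in M. integrable (leb (v - u))
        (\<lambda>z. Y v (merge (v \<inter> u) (v - u) (X \<omega>, z)) * marginal N f (v - u) z)"
  shows "Y {} (\<lambda>_. undefined) = (\<integral>x. y x * f x \<partial>leb {1..N}) \<and>
    (\<forall>u. u \<subseteq> {1..N} \<and> u \<noteq> {} \<longrightarrow>
      (AE \<omega> in M. Y u (restrict (X \<omega>) u) =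
          (\<integral>z. y (merge u ({1..N} - u) (X \<omega>, z)) * marginal N f ({1..N} - u) z \<partial>leb ({1..N} - u))
        - (\<Sum>v | v \<subset> u. Y v (restrict (X \<omega>) v))
        - (\<Sum>v | v \<noteq> {} \<and> v \<subseteq> {1..N} \<and> v \<inter> u \<noteq> {} \<and> \<not> v \<subseteq> u.
             \<integral>z. Y v (merge (v \<inter> u) (v - u) (X \<omega>, z)) * marginal N f (v - u) z \<partial>leb (v - u))))"
proof -
  let ?I = "{1..N}"
  interpret M: prob_space M by fact
  have Xm: "X \<in> M \<rightarrow>\<^sub>M leb ?I" and Xd: "distr M (leb ?I) X = density (leb ?I) (\<lambda>x. ennreal (f x))"
    and fm: "(\<lambda>x. ennreal (f x)) \<in> borel_measurable (leb ?I)"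
    using assms(4) by (auto simp: distributed_def)
  interpret joint_density N f
  proof (rule joint_density.intro)
    \<comment> \<open>\<open>distributed\<close> gives measurability of \<open>ennreal\<close>
      composed with \<open>f\<close>; \<open>enn2real\<close> recovers \<open>f\<close> itself,
      which is nonnegative on the space.\<close>
    have "(\<lambda>x. enn2real (ennreal (f x))) \<in> borel_measurable (leb ?I)"
      using fm by measurable
    then show "f \<in> borel_measurable (leb ?I)"
      using assms(3) by (simp cong: measurable_cong)
    show "prob_space (density (leb ?I) (\<lambda>x. ennreal (f x)))"
      using M.prob_space_distr[OF Xm] Xd by simp
  qed (use assms(3) in auto)
  let ?A = "\<lambda>u. {v. v \<noteq> {} \<and> v \<subseteq> ?I \<and> v \<inter> u \<noteq> {} \<and> \<not> v \<subseteq> u}"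
  \<comment> \<open>The case \<open>u = {}\<close> is included: it yields the constant
    component.\<close>
  have main: "AE \<omega> in M.
      (\<integral>z. y (merge u (?I - u) (X \<omega>, z)) * marginal N f (?I - u) z \<partial>leb (?I - u)) =
      (\<Sum>v\<in>Pow u. Y v (restrict (X \<omega>) v)) +
      (\<Sum>v\<in>?A u. \<integral>z. Y v (merge (v \<inter> u) (v - u) (X \<omega>, z)) * marginal N f (v - u) z \<partial>leb (v - u))"
    if u: "u \<subseteq> ?I" for u
  proof -
    let ?w = "?I - u"
    let ?Q = "\<lambda>x. y x = (\<Sum>v\<in>Pow ?I. Y v (restrict x v))"
    have r: "(\<lambda>x. restrict x u) \<in> leb ?I \<rightarrow>\<^sub>M leb u"
      by (rule measurable_restrict_subset[OF u])
    \<comment> \<open>\<open>law u\<close> is the distribution of X_u, so what holds almost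
      everywhere for it holds almost surely at X_u.\<close>
    have "law u = distr M (leb u) (\<lambda>\<omega>. restrict (X \<omega>) u)"
      unfolding law_eq_distr[OF u] Xd[symmetric] by (simp add: distr_distr[OF r Xm] comp_def)
    moreover have "AE x in law u. AE z in leb ?w. marginal N f ?w z \<noteq> 0 \<longrightarrow> ?Q (merge u ?w (x, z))"
      using assms(8) u unfolding generalized_ADD_def by (intro AE_product_law) blast+
    ultimately have "AE x in distr M (leb u) (\<lambda>\<omega>. restrict (X \<omega>) u).
        AE z in leb ?w. marginal N f ?w z \<noteq> 0 \<longrightarrow> ?Q (merge u ?w (x, z))"
      by (simp only:)
    then have "AE \<omega> in M. AE z in leb ?w. marginal N f ?w z \<noteq> 0 \<longrightarrow>
        ?Q (merge u ?w (restrict (X \<omega>) u, z))"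
      by (rule AE_distrD[OF measurable_compose[OF Xm r]])
    moreover have "merge u ?w (restrict x u, z) = merge u ?w (x, z)" for x z :: "nat \<Rightarrow> real"
      by (auto simp: merge_def)
    ultimately have "AE \<omega> in M. AE z in leb ?w. marginal N f ?w z \<noteq> 0 \<longrightarrow> ?Q (merge u ?w (X \<omega>, z))"
      by (simp only:)
    \<comment> \<open>There are finitely many \<open>v\<close>, hence one null set serves all mixed
      terms.\<close>
    moreover have "AE \<omega> in M. \<forall>v\<in>?A u. integrable (leb (v - u))
        (\<lambda>z. Y v (merge (v \<inter> u) (v - u) (X \<omega>, z)) * marginal N f (v - u) z)"
      using Y_integrals_exist[OF u] by (intro AE_finite_allI) auto
    ultimately show ?thesis
    proof eventually_elim
      case (elim \<omega>)
      show ?case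
        by (rule integral_y_law[OF u assms(8,6) elim(1)]) (use elim(2) in blast)
    qed
  qed
  show ?thesis
  proof (intro conjI allI impI)
    have "merge {} ?I (x, z) = z" if "z \<in> space (leb ?I)" for x z :: "nat \<Rightarrow> real"
      using that by (auto simp: merge_def space_PiM PiE_def extensional_def)
    then have *: "(\<integral>z. y (merge {} ?I (x, z)) * marginal N f ?I z \<partial>leb ?I) = (\<integral>z. y z * f z \<partial>leb ?I)"
      for x :: "nat \<Rightarrow> real"
      using marginal_UNIV by (intro Bochner_Integration.integral_cong) auto
    \<comment> \<open>At \<open>u = {}\<close> there is no mixed \<open>v\<close>, and neither side
      of \<open>main\<close> depends on \<omega>. As \<open>M\<close> has mass 1, the almost sure
      identity is an identity.\<close>
    show "Y {} (\<lambda>_. undefined) = (\<integral>x. y x * f x \<partial>leb ?I)"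
      using main[of "{}"] by (simp add: * restrict_def)
  next
    fix u assume "u \<subseteq> ?I \<and> u \<noteq> {}"
    then have u: "u \<subseteq> ?I" and "finite u" using finite_subset by auto
    \<comment> \<open>Splitting \<open>v = u\<close> off \<open>Pow u\<close> lets the identity be
      solved for the component \<open>Y u\<close>.\<close>
    moreover have "Pow u = insert u {v. v \<subset> u}" by auto
    moreover have "finite {v. v \<subset> u}"
      using \<open>finite u\<close> by (rule_tac finite_subset[of _ "Pow u"]) auto
    ultimately have "(\<Sum>v\<in>Pow u. Y v (restrict x v)) =
        Y u (restrict x u) + (\<Sum>v | v \<subset> u. Y v (restrict x v))" for x
      by simp
    with main[OF u] show "AE \<omega> in M. Y u (restrict (X \<omega>) u) =
          (\<integral>z. y (merge u (?I - u) (X \<omega>, z)) * marginal N f (?I - u) z \<partial>leb (?I - u))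
        - (\<Sum>v | v \<subset> u. Y v (restrict (X \<omega>) v))
        - (\<Sum>v\<in>?A u. \<integral>z. Y v (merge (v \<inter> u) (v - u) (X \<omega>, z)) * marginal N f (v - u) z \<partial>leb (v - u))"
      by (auto elim!: eventually_mono)
  qed
qed

end
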